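(* Let $\xi$ be a nonnegative integer-valued random variable with $\mathbb E\xi=1$ and $0<\sigma^2:=\operatorname{Var}\xi<\infty$, let $p_k:=\mathbb P(\xi=k)$, and let $\mathcal T$ and $\mathcal T_n$ be the Galton--Watson tree and the conditioned Galton--Watson tree of order $n$ with offspring distribution $\xi$. Suppose that $f:\mathfrak T\to\mathbb R$ is a functional with finite support, and that $\gamma^2=0$, where, with $\mu:=\mathbb E f(\mathcal T)$, $$\gamma^2:=2\,\mathbb E\Bigl(f(\mathcal T)\bigl(F(\mathcal T)-|\mathcal T|\mu\bigr)\Bigr)-\operatorname{Var}f(\mathcal T)-\mu^2/\sigma^2 .$$ (i) If the support $\{k:p_k>0\}$ of $\xi$ contains at least two positive integers, then $f(\mathcal T)=F(\mathcal T)=F(\mathcal T_n)=0$ a.s. (for every $n$). (ii) Otherwise, i.e., if $\{k:p_k>0\}=\{0,r\}$ for some $r>1$, then $f(\mathcal T)=a\,\mathbf 1\{|\mathcal T|=1\}$ a.s. for some real $a$, and $F(\mathcal T_n)=a\bigl(n-(n-1)/r\bigr)$ is deterministic.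
   Context: All trees are finite, rooted and ordered (plane). $\mathfrak T$ is the countable set of all such trees (up to isomorphism preserving the root and the orderings of children), and $|T|$ is the number of nodes of $T$. For a node $v$ of $T$, $T_v$ denotes the fringe subtree of $T$ consisting of $v$ and all its descendants. For a functional $f:\mathfrak T\to\mathbb R$, define $F(T):=\sum_{v\in T}f(T_v)$. The functional $f$ has finite support if $f(T)\ne0$ only for finitely many $T\in\mathfrak T$. The Galton--Watson tree $\mathcal T$ with offspring distribution $\xi$ is the random tree obtained by starting with a root and giving each node a number of children that is an independent copy of $\xi$ (under the assumptions it is a.s. finite). The conditioned Galton--Watson tree $\mathcal T_n$ is $\mathcal T$ conditioned on $|\mathcal T|=n$; only $n$ with $\mathbb P(|\mathcal T|=n)>0$ are considered. For $f$ with finite support, the quantity $\gamma^2$ is also equal to $\lim_{n\to\infty}\operatorname{Var}F(\mathcal T_n)/n$. *)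

theory Defs
  imports "HOL-Probability.Probability"
begin

datatype plane_tree = PNode (children: "plane_tree list")

instance plane_tree :: countable
  by countable_datatype

text \<open>Nodes carry their Ulam--Harris addresses: the root is \<^term>\<open>[]\<close>, and
  \<^term>\<open>i # v\<close> is the node with address \<^term>\<open>v\<close> in the subtree of the
  \<^term>\<open>i\<close>-th child of the root, counting children from 0.\<close>

primrec is_node :: "nat list \<Rightarrow> plane_tree \<Rightarrow> bool" where
  "is_node [] t \<longleftrightarrow> True"
| "is_node (i # v) t \<longleftrightarrow> i < length (children t) \<and> is_node v (children t ! i)"

definition nodes :: "plane_tree \<Rightarrow> nat list set" where
  "nodes t = {v. is_node v t}"

text \<open>Only meaningful for \<^term>\<open>v \<in> nodes t\<close>.\<close>

primrec fringe :: "nat list \<Rightarrow> plane_tree \<Rightarrow> plane_tree" where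
  "fringe [] t = t"
| "fringe (i # v) t = fringe v (children t ! i)"

definition outdeg :: "plane_tree \<Rightarrow> nat list \<Rightarrow> nat" where
  "outdeg t v = length (children (fringe v t))"

definition tree_order :: "plane_tree \<Rightarrow> nat" where
  "tree_order t = card (nodes t)"

definition additive_functional :: "(plane_tree \<Rightarrow> real) \<Rightarrow> plane_tree \<Rightarrow> real" where
  "additive_functional f t = (\<Sum>v\<in>nodes t. f (fringe v t))"

lemma nodes_PNode:
  "nodes (PNode ts) = insert [] (\<Union>i<length ts. (#) i ` nodes (ts ! i))" (is "_ = ?R")
proof (rule set_eqI)
  fix v show "v \<in> nodes (PNode ts) \<longleftrightarrow> v \<in> ?R"
    by (cases v) (auto simp: nodes_def)
qed

lemma finite_nodes [simp]: "finite (nodes t)"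
  by (induction t) (simp add: nodes_PNode)

text \<open>The Galton--Watson tree is built from offspring numbers \<^term>\<open>x v\<close> attached to all
  potential addresses \<^term>\<open>v\<close>. If the resulting family tree is infinite then no
  \<^typ>\<open>plane_tree\<close> satisfies the description below, and the value is unspecified; for a critical
  offspring distribution of positive variance this has probability 0.\<close>

definition family_tree :: "(nat list \<Rightarrow> nat) \<Rightarrow> plane_tree" where
  "family_tree x = (THE t. \<forall>v\<in>nodes t. outdeg t v = x v)"

lemma family_tree_unique:
  assumes "\<forall>v\<in>nodes s. outdeg s v = x v" and "\<forall>v\<in>nodes t. outdeg t v = x v"
  shows "s = t"
  using assms
proof (induction s arbitrary: t x)
  case (PNode ss)
  obtain ts where t: "t = PNode ts" by (cases t)
  have len: "length ss = x []" "length ts = x []"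
    using PNode.prems by (auto simp: t nodes_PNode outdeg_def)
  have "ss ! i = ts ! i" if "i < length ss" for i
  proof (rule PNode.IH[of _ "\<lambda>v. x (i # v)"])
    show "ss ! i \<in> set ss" using that by simp
    show "\<forall>v\<in>nodes (ss ! i). outdeg (ss ! i) v = x (i # v)"
      using PNode.prems(1) that by (auto simp: nodes_PNode outdeg_def)
    show "\<forall>v\<in>nodes (ts ! i). outdeg (ts ! i) v = x (i # v)"
      using PNode.prems(2) that len by (auto simp: t nodes_PNode outdeg_def)
  qed
  then show ?case using len by (auto simp: t intro: nth_equalityI)
qed

lemma family_tree_eqI:
  assumes "\<forall>v\<in>nodes t. outdeg t v = x v"
  shows "family_tree x = t"
  unfolding family_tree_def
  using assms family_tree_unique by (intro the_equality) auto

definition offspring_space :: "nat pmf \<Rightarrow> (nat list \<Rightarrow> nat) measure" where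
  "offspring_space p = Pi\<^sub>M UNIV (\<lambda>_. measure_pmf p)"

text \<open>The law of the Galton--Watson tree whose offspring variable has law \<^term>\<open>p\<close>.\<close>

definition GW :: "nat pmf \<Rightarrow> plane_tree measure" where
  "GW p = distr (offspring_space p) (count_space UNIV) family_tree"

text \<open>The law of the Galton--Watson tree conditioned to have order \<^term>\<open>n\<close>; only meaningful
  if that event has positive probability.\<close>

definition GW_cond :: "nat pmf \<Rightarrow> nat \<Rightarrow> plane_tree measure" where
  "GW_cond p n = uniform_measure (GW p) {t. tree_order t = n}"

lemma measurable_family_tree [measurable]:
  "family_tree \<in> measurable (offspring_space p) (count_space UNIV)"
proof -
  let ?M = "offspring_space p"
  let ?Q = "\<lambda>t x. \<forall>v\<in>nodes t. outdeg t v = (x v :: nat)"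
  have Q: "Measurable.pred ?M (?Q t)" for t
  proof -
    have [measurable]: "(\<lambda>x. x v) \<in> measurable ?M (count_space UNIV)" for v
    proof -
      have "(\<lambda>x. x v) \<in> measurable ?M (measure_pmf p)"
        unfolding offspring_space_def by (rule measurable_component_singleton) simp
      then show ?thesis by (simp cong: measurable_cong_sets)
    qed
    show ?thesis
      by (intro pred_intros_finite finite_nodes) measurable
  qed
  have none: "family_tree x = (THE t. False)" if "\<not> (\<exists>t. ?Q t x)" for x
  proof -
    have "(\<lambda>t. ?Q t x) = (\<lambda>t. False)" using that by (intro ext) simp
    then show ?thesis unfolding family_tree_def by simp
  qed
  have "{x \<in> space ?M. family_tree x = t} \<in> sets ?M" for t
  proof -
    have *: "{x \<in> space ?M. family_tree x = t} =
      {x \<in> space ?M. ?Q t x \<or> (\<not> (\<exists>t. ?Q t x) \<and> (THE t. False) = t)}"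
      using family_tree_eqI none by (intro Collect_cong) metis
    have "Measurable.pred ?M (\<lambda>x. ?Q t x \<or> (\<not> (\<exists>t. ?Q t x) \<and> (THE t. False) = t))"
      using Q by measurable
    then show ?thesis unfolding * by measurable
  qed
  then show ?thesis
    by (intro measurable_count_space_eq_countable[THEN iffD2]) (auto simp: vimage_def Int_def conj_commute)
qed

lemma prob_space_GW: "prob_space (GW p)"
proof -
  interpret O: prob_space "offspring_space p"
    unfolding offspring_space_def by (rule prob_space_PiM) (rule measure_pmf.prob_space_axioms)
  show ?thesis unfolding GW_def by (rule O.prob_space_distr) measurable
qed

definition gamma2 :: "nat pmf \<Rightarrow> (plane_tree \<Rightarrow> real) \<Rightarrow> real" where
  "gamma2 p f =
    (let \<mu> = prob_space.expectation (GW p) f in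
      2 * prob_space.expectation (GW p) (\<lambda>t. f t * (additive_functional f t - real (tree_order t) * \<mu>))
      - prob_space.variance (GW p) f
      - \<mu>\<^sup>2 / measure_pmf.variance p real)"

end

theory Submission
  imports Defs
begin

text \<open>The quantity $\gamma^2$ is a quadratic form in $f$. It is nonnegative, because it is the
  eventual increment in $h$ of the second moment of a centred additive functional truncated at
  height $h$. Hence if it vanishes at $f$, so does its polar form between $f$ and every other finitely
  supported functional. Testing with the indicator of a tree $T$ larger than every tree in the
  support of $f$ gives $F(T) = \mu|T| + c$ with $c$ independent of $T$. Hanging large trees below a
  common root of outdegree $k$, where $f$ vanishes, forces $\mu = (k-1)c$ for every positive $k$ in the
  support of $\xi$, and attaching a small tree next to large ones extends the affine formula to all
  trees of positive probability.\<close>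

subsection \<open>The Galton--Watson law as a probability mass function\<close>

text \<open>Splitting off the root leaves the disjoint, address-shifted node sets of the children.
  An arbitrary commutative monoid lets one argument serve sums (functionals, order) and products
  (weights).\<close>

lemma (in comm_monoid_set) nodes_PNode:
  "F (\<lambda>v. h (fringe v (PNode ts))) (nodes (PNode ts)) =
    h (PNode ts) \<^bold>* F (\<lambda>i. F (\<lambda>v. h (fringe v (ts ! i))) (nodes (ts ! i))) {..<length ts}"
proof -
  have "F (\<lambda>v. h (fringe v (PNode ts))) (nodes (PNode ts)) =
      h (PNode ts) \<^bold>* F (\<lambda>v. h (fringe v (PNode ts))) (\<Union>i<length ts. (#) i ` nodes (ts ! i))"
    unfolding Defs.nodes_PNode by (subst insert) auto
  also have "F (\<lambda>v. h (fringe v (PNode ts))) (\<Union>i<length ts. (#) i ` nodes (ts ! i)) =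
      F (\<lambda>i. F (\<lambda>v. h (fringe v (PNode ts))) ((#) i ` nodes (ts ! i))) {..<length ts}"
    by (rule UNION_disjoint) auto
  also have "\<dots> = F (\<lambda>i. F (\<lambda>v. h (fringe v (ts ! i))) (nodes (ts ! i))) {..<length ts}"
  proof (rule cong[OF refl])
    fix i
    show "F (\<lambda>v. h (fringe v (PNode ts))) ((#) i ` nodes (ts ! i)) =
        F (\<lambda>v. h (fringe v (ts ! i))) (nodes (ts ! i))"
      by (subst reindex) (auto simp: comp_def)
  qed
  finally show ?thesis .
qed

lemma additive_functional_PNode:
  "additive_functional f (PNode ts) = f (PNode ts) + (\<Sum>t\<leftarrow>ts. additive_functional f t)"
  unfolding additive_functional_def
  by (subst sum.nodes_PNode) (simp add: sum.list_conv_set_nth atLeast0LessThan)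

lemma additive_functional_children:
  "additive_functional f t = f t + (\<Sum>c\<leftarrow>children t. additive_functional f c)"
  using additive_functional_PNode[of f "children t"] by simp

lemma tree_order_conv: "real (tree_order t) = additive_functional (\<lambda>_. 1) t"
  by (simp add: tree_order_def additive_functional_def)

lemma tree_order_PNode: "tree_order (PNode ts) = Suc (\<Sum>t\<leftarrow>ts. tree_order t)"
  using sum.nodes_PNode[where h = "\<lambda>_. 1 :: nat" and ts = ts]
  by (simp add: tree_order_def sum.list_conv_set_nth atLeast0LessThan)

lemma tree_order_child_less: "c \<in> set ts \<Longrightarrow> tree_order c < tree_order (PNode ts)"
  by (simp add: tree_order_PNode less_Suc_eq_le member_le_sum_list)

text \<open>The usual Galton-Watson probability of a finite tree.\<close>

definition tree_weight :: "nat pmf \<Rightarrow> plane_tree \<Rightarrow> real" where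
  "tree_weight p t = (\<Prod>v\<in>nodes t. pmf p (outdeg t v))"

lemma tree_weight_nonneg: "0 \<le> tree_weight p t"
  by (simp add: tree_weight_def prod_nonneg)

lemma tree_weight_PNode:
  "tree_weight p (PNode ts) = pmf p (length ts) * (\<Prod>t\<leftarrow>ts. tree_weight p t)"
  unfolding tree_weight_def outdeg_def
  by (subst prod.nodes_PNode[where h = "\<lambda>s. pmf p (length (children s))"])
     (simp add: prod.list_conv_set_nth atLeast0LessThan)

text \<open>Prescribing the offspring numbers on the finitely many nodes of \<open>t\<close> is a
  cylinder event of product mass. Only an inequality at this stage: the unspecified value of
  \<open>family_tree\<close> on infinite family trees could be \<open>t\<close> too.\<close>

lemma emeasure_GW_ge: "ennreal (tree_weight p t) \<le> emeasure (GW p) {t}"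
proof -
  interpret product_prob_space "\<lambda>_. measure_pmf p" "UNIV :: nat list set"
    by unfold_locales
  let ?A = "{x\<in>space (offspring_space p). \<forall>v\<in>nodes t. x v \<in> {outdeg t v}}"
  have "emeasure (offspring_space p) ?A = (\<Prod>v\<in>nodes t. emeasure (measure_pmf p) {outdeg t v})"
    unfolding offspring_space_def by (rule emeasure_PiM_Collect) auto
  also have "\<dots> = ennreal (tree_weight p t)"
    by (simp add: emeasure_pmf_single prod_ennreal tree_weight_def)
  finally have "ennreal (tree_weight p t) = emeasure (offspring_space p) ?A" ..
  also have "\<dots> \<le> emeasure (offspring_space p) (family_tree -` {t} \<inter> space (offspring_space p))"
  proof (rule emeasure_mono)
    show "?A \<subseteq> family_tree -` {t} \<inter> space (offspring_space p)"
      by (auto intro!: family_tree_eqI)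
    show "family_tree -` {t} \<inter> space (offspring_space p) \<in> sets (offspring_space p)"
      by (rule measurable_sets[OF measurable_family_tree]) auto
  qed
  also have "\<dots> = emeasure (GW p) {t}"
    unfolding GW_def by (subst emeasure_distr) auto
  finally show ?thesis .
qed

section \<open>Total mass of the tree weights\<close>

lemma nn_integral_list_by_length:
  fixes g :: "'a list \<Rightarrow> ennreal"
  shows "(\<integral>\<^sup>+xs. g xs \<partial>count_space UNIV) =
    (\<integral>\<^sup>+k. \<integral>\<^sup>+xs. g xs * indicator {k} (length xs) \<partial>count_space UNIV \<partial>count_space UNIV)"
proof -
  have "(\<integral>\<^sup>+xs. g xs \<partial>count_space UNIV) =
      (\<integral>\<^sup>+xs. \<integral>\<^sup>+k. g xs * indicator {length xs} k \<partial>count_space UNIV \<partial>count_space UNIV)"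
    by (simp add: nn_integral_cmult_indicator)
  also have "\<dots> = (\<integral>\<^sup>+k. \<integral>\<^sup>+xs. g xs * indicator {length xs} k \<partial>count_space UNIV \<partial>count_space UNIV)"
    using nn_integral_fst_count_space[of "\<lambda>(xs, k). g xs * indicator {length xs} k"]
      nn_integral_snd_count_space[of "\<lambda>(xs, k). g xs * indicator {length xs} k"]
    by simp
  finally show ?thesis
    by (simp add: indicator_def eq_commute)
qed

lemma nn_integral_lists_of_length:
  fixes w :: "'a \<Rightarrow> ennreal"
  shows "(\<integral>\<^sup>+xs. (\<Prod>x\<leftarrow>xs. w x) * indicator {k} (length xs) \<partial>count_space UNIV) =
    (\<integral>\<^sup>+x. w x \<partial>count_space UNIV) ^ k"
proof (induction k)
  case 0
  have "(\<integral>\<^sup>+xs. (\<Prod>x\<leftarrow>xs. w x) * indicator {0} (length xs) \<partial>count_space UNIV) =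
      (\<integral>\<^sup>+xs. indicator {[]} (xs :: 'a list) \<partial>count_space UNIV)"
    by (intro nn_integral_cong) (auto simp: indicator_def)
  then show ?case by simp
next
  case (Suc k)
  let ?g = "\<lambda>xs. (\<Prod>x\<leftarrow>xs. w x) * indicator {Suc k} (length xs)"
  have bij: "bij_betw (\<lambda>(x, xs). x # xs) UNIV {xs :: 'a list. xs \<noteq> []}"
    by (rule bij_betwI[where g = "\<lambda>xs. (hd xs, tl xs)"]) auto
  have "(\<integral>\<^sup>+xs. ?g xs \<partial>count_space UNIV) = (\<integral>\<^sup>+xs. ?g xs \<partial>count_space {xs. xs \<noteq> []})"
    by (rule nn_integral_count_space_eq) (auto simp: indicator_def)
  also have "\<dots> = (\<integral>\<^sup>+y. ?g (case y of (x, xs) \<Rightarrow> x # xs) \<partial>count_space UNIV)"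
    by (rule nn_integral_bij_count_space[OF bij, symmetric])
  also have "\<dots> = (\<integral>\<^sup>+x. \<integral>\<^sup>+xs. ?g (x # xs) \<partial>count_space UNIV \<partial>count_space UNIV)"
    by (subst nn_integral_fst_count_space[symmetric]) simp
  also have "\<dots> = (\<integral>\<^sup>+x. w x * (\<integral>\<^sup>+xs. (\<Prod>x\<leftarrow>xs. w x) * indicator {k} (length xs) \<partial>count_space UNIV)
      \<partial>count_space UNIV)"
    by (subst nn_integral_cmult[symmetric]) (auto intro!: nn_integral_cong simp: indicator_def mult.assoc)
  also have "\<dots> = (\<integral>\<^sup>+x. w x \<partial>count_space UNIV) ^ Suc k"
    unfolding Suc by (simp add: nn_integral_multc)
  finally show ?case .
qed

text \<open>The extinction equation q = G(q), with G the offspring generating function: at root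
  degree \<open>k\<close> the weight factorizes over the list of children, and summing over such
  lists gives q^k.\<close>

lemma tree_weight_fixed_point:
  "(\<integral>\<^sup>+t. tree_weight p t \<partial>count_space UNIV) =
    (\<integral>\<^sup>+k. (\<integral>\<^sup>+t. tree_weight p t \<partial>count_space UNIV) ^ k \<partial>measure_pmf p)"
proof -
  let ?q = "\<integral>\<^sup>+t. tree_weight p t \<partial>count_space UNIV"
  have bij: "bij_betw PNode UNIV UNIV"
    by (rule bij_betwI[where g = children]) auto
  have prod: "(\<Prod>t\<leftarrow>ts. ennreal (tree_weight p t)) = ennreal (\<Prod>t\<leftarrow>ts. tree_weight p t)" for ts
    by (induction ts) (auto simp: ennreal_mult' tree_weight_nonneg)
  have "?q = (\<integral>\<^sup>+ts. tree_weight p (PNode ts) \<partial>count_space UNIV)"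
    by (rule nn_integral_bij_count_space[OF bij, symmetric])
  also have "\<dots> = (\<integral>\<^sup>+ts. pmf p (length ts) * (\<Prod>t\<leftarrow>ts. ennreal (tree_weight p t)) \<partial>count_space UNIV)"
    by (simp add: tree_weight_PNode prod ennreal_mult')
  also have "\<dots> = (\<integral>\<^sup>+k. \<integral>\<^sup>+ts. pmf p k * ((\<Prod>t\<leftarrow>ts. ennreal (tree_weight p t)) *
      indicator {k} (length ts)) \<partial>count_space UNIV \<partial>count_space UNIV)"
    by (subst nn_integral_list_by_length, intro nn_integral_cong) (auto simp: indicator_def)
  also have "\<dots> = (\<integral>\<^sup>+k. pmf p k * ?q ^ k \<partial>count_space UNIV)"
    by (simp add: nn_integral_cmult nn_integral_lists_of_length)
  finally show ?thesis by (simp add: nn_integral_measure_pmf)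
qed

lemma tree_weight_total_le_1: "(\<integral>\<^sup>+t. tree_weight p t \<partial>count_space UNIV) \<le> 1"
proof -
  interpret prob_space "GW p" by (rule prob_space_GW)
  have sets: "sets (GW p) = UNIV" "space (GW p) = UNIV" by (auto simp: GW_def)
  have "(\<integral>\<^sup>+t. tree_weight p t \<partial>count_space UNIV) \<le> (\<integral>\<^sup>+t. emeasure (GW p) {t} \<partial>count_space UNIV)"
    by (intro nn_integral_mono emeasure_GW_ge)
  also have "\<dots> = emeasure (GW p) UNIV"
    by (rule emeasure_countable_singleton[symmetric]) (auto simp: sets)
  also have "\<dots> = 1" using emeasure_space_1 by (simp add: sets)
  finally show ?thesis .
qed

locale critical_offspring =
  fixes p :: "nat pmf"
  assumes mean: "measure_pmf.expectation p real = 1"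
    and var_finite: "integrable (measure_pmf p) (\<lambda>k. (real k)\<^sup>2)"
    and var_pos: "measure_pmf.variance p real > 0"
begin

lemma integrable_offspring: "integrable (measure_pmf p) real"
proof (rule Bochner_Integration.integrable_bound[OF var_finite])
  show "AE k in measure_pmf p. norm (real k) \<le> norm ((real k)\<^sup>2)"
    by (auto simp: power2_eq_square le_square simp flip: of_nat_mult)
qed simp

lemma not_AE_1: "\<not> (AE k in measure_pmf p. k = 1)"
proof
  assume "AE k in measure_pmf p. k = 1"
  then have "measure_pmf.variance p real = (\<integral>k. 0 \<partial>measure_pmf p)"
    unfolding mean by (intro integral_cong_AE) auto
  then show False using var_pos by simp
qed

text \<open>The variable \<open>real k - 1\<close> has mean 0, so it vanishes a.s. once it has
  constant sign. The factor \<open>s\<close> covers both signs, which yields mass at 0 and at some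
  \<open>r \<ge> 2\<close>.\<close>

lemma AE_eq_1_I:
  assumes "AE k in measure_pmf p. s * (real k - 1) \<ge> 0" "s \<noteq> 0"
  shows "AE k in measure_pmf p. k = 1"
proof -
  have "(\<integral>k. s * (real k - 1) \<partial>measure_pmf p) = 0"
    using integrable_offspring mean by simp
  then have "AE k in measure_pmf p. s * (real k - 1) = 0"
    using assms(1) integrable_offspring by (subst (asm) integral_nonneg_eq_0_iff_AE) auto
  then show ?thesis by (rule AE_mp) (use assms(2) in auto)
qed

lemma pmf_0_pos: "pmf p 0 > 0"
proof (rule ccontr)
  assume "\<not> pmf p 0 > 0"
  then have "0 \<notin> set_pmf p" by (simp add: pmf_positive_iff)
  then have "AE k in measure_pmf p. 1 * (real k - 1) \<ge> 0"
    by (auto simp: AE_measure_pmf_iff) (metis One_nat_def Suc_leI gr0I)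
  from AE_eq_1_I[OF this] not_AE_1 show False by simp
qed

lemma ex_ge_2: "\<exists>r\<ge>2. pmf p r > 0"
proof (rule ccontr)
  assume "\<not> ?thesis"
  then have "AE k in measure_pmf p. -1 * (real k - 1) \<ge> 0"
    by (auto simp: AE_measure_pmf_iff pmf_positive_iff not_less_eq_eq numeral_2_eq_2)
  from AE_eq_1_I[OF this] not_AE_1 show False by simp
qed

text \<open>Bernoulli's inequality gives s^k >= 1 - k(1 - s). For a fixed point s of G and offspring
  mean 1 both sides have mean s, so equality holds on the support; at some \<open>r \<ge> 2\<close>
  this forces s = 1.\<close>

lemma tree_weight_total: "(\<integral>\<^sup>+t. tree_weight p t \<partial>count_space UNIV) = 1"
proof -
  let ?q = "\<integral>\<^sup>+t. tree_weight p t \<partial>count_space UNIV"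
  obtain s where s: "?q = ennreal s" "0 \<le> s" "s \<le> 1"
    using tree_weight_total_le_1[of p] by (cases ?q) (auto simp: top_unique)
  have int_pow: "integrable (measure_pmf p) (\<lambda>k. s ^ k)"
    by (rule measure_pmf.integrable_const_bound[where B = 1]) (use s in \<open>auto simp: power_le_one\<close>)
  have "ennreal (\<integral>k. s ^ k \<partial>measure_pmf p) = (\<integral>\<^sup>+k. (ennreal s) ^ k \<partial>measure_pmf p)"
    using s by (simp add: ennreal_power nn_integral_eq_integral[OF int_pow])
  also have "\<dots> = ennreal s" using tree_weight_fixed_point[of p] by (simp add: s)
  finally have "(\<integral>k. s ^ k \<partial>measure_pmf p) = s"
    using s by (simp add: integral_nonneg)
  then have "(\<integral>k. s ^ k - 1 + real k * (1 - s) \<partial>measure_pmf p) = 0"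
    using int_pow integrable_offspring by (simp add: mean)
  moreover have nonneg: "s ^ k - 1 + real k * (1 - s) \<ge> 0" for k
    using Bernoulli_inequality[of "s - 1" k] s by (simp add: algebra_simps)
  ultimately have AE: "AE k in measure_pmf p. s ^ k - 1 + real k * (1 - s) = 0"
    using int_pow integrable_offspring by (subst (asm) integral_nonneg_eq_0_iff_AE) auto
  obtain r where r: "r \<ge> 2" "pmf p r > 0" using ex_ge_2 by blast
  then have "s ^ r - 1 + real r * (1 - s) = 0"
    using AE by (simp add: AE_measure_pmf_iff pmf_positive_iff)
  then have eq: "(1 - s) * (real r - (\<Sum>i<r. s ^ i)) = 0"
    using one_diff_power_eq[of s r] by (simp add: algebra_simps)
  have "s = 1"
  proof (rule ccontr)
    assume "s \<noteq> 1"
    then have "s < 1" using s by simp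
    \<comment> \<open>The index 1, present because \<open>r \<ge> 2\<close>, makes the sum strictly
      smaller.\<close>
    then have "(\<Sum>i<r. s ^ i) < (\<Sum>i<r. 1)"
      using r s by (intro sum_strict_mono_ex1) (auto intro!: bexI[of _ 1] power_le_one)
    with eq \<open>s \<noteq> 1\<close> show False by simp
  qed
  with s show ?thesis by simp
qed

definition tree_pmf :: "plane_tree pmf" where
  "tree_pmf = embed_pmf (tree_weight p)"

lemma pmf_tree_pmf: "pmf tree_pmf t = tree_weight p t"
  unfolding tree_pmf_def by (rule pmf_embed_pmf) (auto simp: tree_weight_nonneg tree_weight_total)

lemma pmf_tree_PNode:
  "pmf tree_pmf (PNode ts) = pmf p (length ts) * (\<Prod>t\<leftarrow>ts. pmf tree_pmf t)"
  by (simp add: pmf_tree_pmf tree_weight_PNode)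

text \<open>The bound \<open>emeasure_GW_ge\<close> on singletons sums to the same bound on the
  complement of \<open>{t}\<close>. Both measures have total mass 1, so complements give the reverse
  inequality at \<open>t\<close>.\<close>

lemma GW_eq: "GW p = measure_pmf tree_pmf"
proof -
  interpret prob_space "GW p" by (rule prob_space_GW)
  have sets: "sets (GW p) = UNIV" "space (GW p) = UNIV" by (auto simp: GW_def)
  have "emeasure (measure_pmf tree_pmf) {t} = emeasure (GW p) {t}" for t
  proof -
    have le: "emeasure (measure_pmf tree_pmf) {t} \<le> emeasure (GW p) {t}" for t
      using emeasure_GW_ge[of p t] by (simp add: emeasure_pmf_single pmf_tree_pmf)
    have "emeasure (measure_pmf tree_pmf) (-{t}) \<le> emeasure (GW p) (-{t})"
    proof -
      have "emeasure (measure_pmf tree_pmf) (-{t}) = (\<integral>\<^sup>+s. emeasure (measure_pmf tree_pmf) {s} \<partial>count_space (-{t}))"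
        by (rule emeasure_countable_singleton) auto
      also have "\<dots> \<le> (\<integral>\<^sup>+s. emeasure (GW p) {s} \<partial>count_space (-{t}))"
        by (intro nn_integral_mono le)
      also have "\<dots> = emeasure (GW p) (-{t})"
        by (rule emeasure_countable_singleton[symmetric]) (auto simp: sets)
      finally show ?thesis .
    qed
    then have "1 - measure (measure_pmf tree_pmf) {t} \<le> 1 - prob {t}"
      using prob_compl[of "{t}"] measure_pmf.prob_compl[of "{t}" tree_pmf]
      by (simp add: sets emeasure_eq_measure measure_pmf.emeasure_eq_measure Compl_eq_Diff_UNIV)
    with le[of t] show ?thesis
      by (simp add: emeasure_eq_measure measure_pmf.emeasure_eq_measure)
  qed
  then show ?thesis
    by (intro measure_eqI_countable[where A = UNIV]) (auto simp: sets)
qed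

end

subsection \<open>Nonnegativity of the variance form\<close>

lemma pmf_replicate_pmf:
  "pmf (replicate_pmf k q) xs = (if length xs = k then (\<Prod>x\<leftarrow>xs. pmf q x) else 0)"
proof (induction k arbitrary: xs)
  case 0
  show ?case by simp
next
  case (Suc k)
  have rep: "replicate_pmf (Suc k) q = map_pmf (\<lambda>(x, xs). x # xs) (pair_pmf q (replicate_pmf k q))"
    by (simp add: pair_pmf_def map_bind_pmf)
  show ?case
  proof (cases xs)
    case Nil
    then show ?thesis
      using set_replicate_pmf[of "Suc k" q] by (simp add: pmf_eq_0_set_pmf del: replicate_pmf.simps)
  next
    case (Cons y ys)
    have "pmf (map_pmf (\<lambda>(x, xs). x # xs) (pair_pmf q (replicate_pmf k q)))
        ((\<lambda>(x, xs). x # xs) (y, ys)) = pmf (pair_pmf q (replicate_pmf k q)) (y, ys)"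
      by (rule pmf_map_inj') (auto simp: inj_on_def)
    then show ?thesis by (simp add: rep Cons pmf_pair Suc del: replicate_pmf.simps)
  qed
qed

text \<open>Variances of independent centred summands add. The shift \<open>a\<close> is general so
  that the induction can absorb the first summand into it; nonnegative integrals let the computation
  also deliver integrability.\<close>

lemma nn_integral_replicate_square:
  fixes Z :: "'a \<Rightarrow> real"
  assumes Z2: "integrable (measure_pmf q) (\<lambda>x. (Z x)\<^sup>2)"
    and Z0: "measure_pmf.expectation q Z = 0"
  shows "(\<integral>\<^sup>+xs. ennreal ((a + (\<Sum>x\<leftarrow>xs. Z x))\<^sup>2) \<partial>replicate_pmf k q) =
    ennreal (a\<^sup>2 + real k * measure_pmf.expectation q (\<lambda>x. (Z x)\<^sup>2))"
proof (induction k arbitrary: a)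
  case 0
  show ?case by (simp add: nn_integral_return_pmf)
next
  case (Suc k)
  let ?v = "measure_pmf.expectation q (\<lambda>x. (Z x)\<^sup>2)"
  have Z1: "integrable (measure_pmf q) Z"
    by (rule measure_pmf.square_integrable_imp_integrable) (use Z2 in auto)
  have v: "?v \<ge> 0" by simp
  have int: "integrable (measure_pmf q) (\<lambda>x. (a + Z x)\<^sup>2 + real k * ?v)"
    using Z1 Z2 by (simp add: power2_sum)
  have "(\<integral>\<^sup>+xs. ennreal ((a + (\<Sum>x\<leftarrow>xs. Z x))\<^sup>2) \<partial>replicate_pmf (Suc k) q) =
      (\<integral>\<^sup>+x. \<integral>\<^sup>+xs. ennreal (((a + Z x) + (\<Sum>x\<leftarrow>xs. Z x))\<^sup>2) \<partial>replicate_pmf k q \<partial>measure_pmf q)"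
    by (simp add: add.assoc)
  also have "\<dots> = (\<integral>\<^sup>+x. ennreal ((a + Z x)\<^sup>2 + real k * ?v) \<partial>measure_pmf q)"
    by (simp only: Suc.IH)
  also have "\<dots> = ennreal (\<integral>x. (a + Z x)\<^sup>2 + real k * ?v \<partial>measure_pmf q)"
    by (rule nn_integral_eq_integral[OF int]) (simp add: v)
  also have "(\<integral>x. (a + Z x)\<^sup>2 + real k * ?v \<partial>measure_pmf q) = a\<^sup>2 + real (Suc k) * ?v"
    using Z1 Z2 by (simp add: power2_sum Z0 algebra_simps)
  finally show ?case .
qed

lemma integrable_finite_support:
  fixes f :: "'a \<Rightarrow> real"
  assumes "finite {x. f x \<noteq> 0}"
  shows "integrable (measure_pmf q) f"
proof (rule measure_pmf.integrable_const_bound[where B = "\<Sum>x | f x \<noteq> 0. \<bar>f x\<bar>"])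
  have "\<bar>f x\<bar> \<le> (\<Sum>x | f x \<noteq> 0. \<bar>f x\<bar>)" for x
  proof (cases "f x = 0")
    case False
    then show ?thesis using assms by (intro member_le_sum) auto
  qed (simp add: sum_nonneg)
  then show "AE x in measure_pmf q. norm (f x) \<le> (\<Sum>x | f x \<noteq> 0. \<bar>f x\<bar>)" by simp
qed simp

section \<open>Additive functionals and their truncation\<close>

lemma additive_functional_add:
  "additive_functional (\<lambda>t. f t + g t) t = additive_functional f t + additive_functional g t"
  by (simp add: additive_functional_def sum.distrib)

lemma additive_functional_cmult:
  "additive_functional (\<lambda>t. c * f t) t = c * additive_functional f t"
  by (simp add: additive_functional_def sum_distrib_left)

text \<open>There is one node more than there are edges. Hence multiples of outdegree minus 1 can be
  added to a toll function at the cost of a constant.\<close>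

lemma additive_functional_outdeg:
  "additive_functional (\<lambda>t. real (length (children t)) - 1) t = -1"
proof (induction t)
  case (PNode ts)
  then have "(\<Sum>t\<leftarrow>ts. additive_functional (\<lambda>t. real (length (children t)) - 1) t) = (\<Sum>t\<leftarrow>ts. -1)"
    by (intro arg_cong[where f = sum_list] map_cong) auto
  then show ?case by (simp add: additive_functional_PNode sum_list_triv)
qed

text \<open>Only nodes of depth less than \<open>h\<close> contribute, each with its whole fringe
  subtree. This keeps second moments finite, which fails in general for the full functional since a
  critical tree has infinite mean order.\<close>

primrec truncated_functional :: "(plane_tree \<Rightarrow> real) \<Rightarrow> nat \<Rightarrow> plane_tree \<Rightarrow> real" where
  "truncated_functional f 0 t = 0"
| "truncated_functional f (Suc h) t = f t + (\<Sum>c\<leftarrow>children t. truncated_functional f h c)"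

text \<open>Every depth in a tree is less than its order.\<close>

lemma truncated_functional_eq:
  "tree_order t \<le> h \<Longrightarrow> truncated_functional f h t = additive_functional f t"
proof (induction h arbitrary: t)
  case 0
  then show ?case by (cases t) (simp add: tree_order_PNode)
next
  case (Suc h)
  have "truncated_functional f h c = additive_functional f c" if "c \<in> set (children t)" for c
    using tree_order_child_less[OF that] Suc.prems by (intro Suc.IH) simp
  then show ?case
    by (simp add: additive_functional_children[of f t] cong: map_cong)
qed

section \<open>Second-moment recursion at the root\<close>

context critical_offspring
begin

lemma tree_pmf_unfold:
  "tree_pmf = bind_pmf p (\<lambda>k. map_pmf PNode (replicate_pmf k tree_pmf))"
proof (rule pmf_eqI)
  fix t
  obtain ts where t: "t = PNode ts" by (cases t)
  have "pmf (bind_pmf p (\<lambda>k. map_pmf PNode (replicate_pmf k tree_pmf))) t =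
      (\<integral>k. pmf (replicate_pmf k tree_pmf) ts \<partial>measure_pmf p)"
    unfolding pmf_bind t by (subst pmf_map_inj') (auto simp: inj_on_def)
  also have "\<dots> = (\<Sum>k\<in>{length ts}. pmf (replicate_pmf k tree_pmf) ts * pmf p k)"
    by (rule integral_measure_pmf_real) (auto simp: pmf_replicate_pmf split: if_splits)
  also have "\<dots> = pmf tree_pmf t"
    by (simp add: t pmf_replicate_pmf pmf_tree_PNode)
  finally show "pmf tree_pmf t = pmf (bind_pmf p (\<lambda>k. map_pmf PNode (replicate_pmf k tree_pmf))) t" ..
qed

abbreviation "E \<equiv> measure_pmf.expectation tree_pmf"

abbreviation square_integrable :: "(plane_tree \<Rightarrow> real) \<Rightarrow> bool" where
  "square_integrable X \<equiv> integrable (measure_pmf tree_pmf) (\<lambda>t. (X t)\<^sup>2)"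

text \<open>Given root degree \<open>k\<close>, the independent centred values at the children leave
  the second moment g(k)^2 + k E(Z^2). Averaging over \<open>k\<close> with offspring mean 1 gives
  E(Z^2) the coefficient 1.\<close>

lemma
  fixes g :: "nat \<Rightarrow> real"
  assumes Z2: "square_integrable Z" and Z0: "E Z = 0"
    and g2: "integrable (measure_pmf p) (\<lambda>k. (g k)\<^sup>2)"
  defines "W \<equiv> \<lambda>t. g (length (children t)) + (\<Sum>c\<leftarrow>children t. Z c)"
  shows square_integrable_branching: "square_integrable W"
    and expectation_branching_square:
      "E (\<lambda>t. (W t)\<^sup>2) = measure_pmf.expectation p (\<lambda>k. (g k)\<^sup>2) + E (\<lambda>t. (Z t)\<^sup>2)"
proof -
  let ?v = "E (\<lambda>t. (Z t)\<^sup>2)"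
  have v: "?v \<ge> 0" by simp
  have "(\<integral>\<^sup>+t. ennreal ((W t)\<^sup>2) \<partial>tree_pmf) =
      (\<integral>\<^sup>+k. \<integral>\<^sup>+ts. ennreal ((W (PNode ts))\<^sup>2) \<partial>replicate_pmf k tree_pmf \<partial>measure_pmf p)"
    by (subst tree_pmf_unfold) simp
  also have "\<dots> = (\<integral>\<^sup>+k. \<integral>\<^sup>+ts. ennreal ((g k + (\<Sum>t\<leftarrow>ts. Z t))\<^sup>2)
      \<partial>replicate_pmf k tree_pmf \<partial>measure_pmf p)"
    by (intro nn_integral_cong nn_integral_cong_AE)
       (auto simp: W_def AE_measure_pmf_iff set_replicate_pmf)
  also have "\<dots> = (\<integral>\<^sup>+k. ennreal ((g k)\<^sup>2 + real k * ?v) \<partial>measure_pmf p)"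
    by (simp only: nn_integral_replicate_square[OF Z2 Z0])
  also have "\<dots> = ennreal (\<integral>k. (g k)\<^sup>2 + real k * ?v \<partial>measure_pmf p)"
    using g2 integrable_offspring by (intro nn_integral_eq_integral) (auto simp: v)
  also have "(\<integral>k. (g k)\<^sup>2 + real k * ?v \<partial>measure_pmf p) =
      measure_pmf.expectation p (\<lambda>k. (g k)\<^sup>2) + ?v"
    using g2 integrable_offspring by (simp add: mean)
  finally have *: "(\<integral>\<^sup>+t. ennreal ((W t)\<^sup>2) \<partial>tree_pmf) =
      ennreal (measure_pmf.expectation p (\<lambda>k. (g k)\<^sup>2) + ?v)" .
  then show "square_integrable W"
    by (intro integrableI_nn_integral_finite[OF _ _ *]) auto
  show "E (\<lambda>t. (W t)\<^sup>2) = measure_pmf.expectation p (\<lambda>k. (g k)\<^sup>2) + ?v"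
    by (rule integral_eq_nn_integral[THEN trans]) (simp_all add: * v del: ennreal_plus)
qed

text \<open>Comparing the second moments for \<^term>\<open>g\<close> and \<^term>\<open>\<lambda>k. g k + 1\<close> isolates the mean, which avoids
  Fubini for signed functions.\<close>

lemma expectation_branching:
  fixes g :: "nat \<Rightarrow> real"
  assumes Z2: "square_integrable Z" and Z0: "E Z = 0"
    and g2: "integrable (measure_pmf p) (\<lambda>k. (g k)\<^sup>2)"
  shows "E (\<lambda>t. g (length (children t)) + (\<Sum>c\<leftarrow>children t. Z c)) = measure_pmf.expectation p g"
proof -
  define W where "W = (\<lambda>t. g (length (children t)) + (\<Sum>c\<leftarrow>children t. Z c))"
  have g1: "integrable (measure_pmf p) g"
    by (rule measure_pmf.square_integrable_imp_integrable) (use g2 in auto)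
  have g2': "integrable (measure_pmf p) (\<lambda>k. (g k + 1)\<^sup>2)"
    using g1 g2 by (simp add: power2_sum)
  have W2: "square_integrable W"
    unfolding W_def by (rule square_integrable_branching[OF Z2 Z0 g2])
  have W1: "integrable (measure_pmf tree_pmf) W"
    by (rule measure_pmf.square_integrable_imp_integrable) (use W2 in auto)
  have "E (\<lambda>t. (W t + 1)\<^sup>2) = measure_pmf.expectation p (\<lambda>k. (g k + 1)\<^sup>2) + E (\<lambda>t. (Z t)\<^sup>2)"
    using expectation_branching_square[OF Z2 Z0 g2'] by (simp add: W_def ac_simps)
  moreover have "E (\<lambda>t. (W t)\<^sup>2) = measure_pmf.expectation p (\<lambda>k. (g k)\<^sup>2) + E (\<lambda>t. (Z t)\<^sup>2)"
    unfolding W_def by (rule expectation_branching_square[OF Z2 Z0 g2])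
  ultimately have "E W = measure_pmf.expectation p g"
    using W1 W2 g1 g2 by (simp add: power2_sum)
  then show ?thesis by (simp add: W_def)
qed

lemma gamma2_eq:
  assumes f: "finite {t. f t \<noteq> 0}"
  shows "gamma2 p f = 2 * E (\<lambda>t. f t * (additive_functional f t - real (tree_order t) * E f))
    - (E (\<lambda>t. (f t)\<^sup>2) - (E f)\<^sup>2) - (E f)\<^sup>2 / measure_pmf.variance p real"
proof -
  have "integrable (measure_pmf tree_pmf) f" "square_integrable f"
    using f by (auto intro: integrable_finite_support)
  then show ?thesis
    by (simp add: gamma2_def Let_def GW_eq measure_pmf.variance_eq)
qed

text \<open>\<open>X (Suc h)\<close> is f + W with W the branching part built from
  \<open>X h\<close>. Since E W is the mean of \<open>g\<close>, hypothesis \<open>fg\<close>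
  preserves centring. The identity (f + W)^2 = W^2 - f^2 + 2 f (f + W) puts the mixed term in terms
  of \<open>X (Suc h)\<close>, which can be replaced by the full functional on the support of
  \<open>f\<close> once \<open>h\<close> is large.\<close>

lemma truncated_functional_moments:
  fixes g :: "nat \<Rightarrow> real"
  assumes f: "finite {t. f t \<noteq> 0}"
    and g2: "integrable (measure_pmf p) (\<lambda>k. (g k)\<^sup>2)"
    and fg: "E f + measure_pmf.expectation p g = 0"
  defines "X \<equiv> truncated_functional (\<lambda>t. f t + g (length (children t)))"
  shows "square_integrable (X h) \<and> E (X h) = 0 \<and>
    E (\<lambda>t. (X (Suc h) t)\<^sup>2) = E (\<lambda>t. (X h t)\<^sup>2) + measure_pmf.expectation p (\<lambda>k. (g k)\<^sup>2)
      - E (\<lambda>t. (f t)\<^sup>2) + 2 * E (\<lambda>t. f t * X (Suc h) t)"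
proof -
  have step: "square_integrable (X (Suc h)) \<and> E (X (Suc h)) = 0 \<and>
      E (\<lambda>t. (X (Suc h) t)\<^sup>2) = E (\<lambda>t. (X h t)\<^sup>2) + measure_pmf.expectation p (\<lambda>k. (g k)\<^sup>2)
        - E (\<lambda>t. (f t)\<^sup>2) + 2 * E (\<lambda>t. f t * X (Suc h) t)"
    if Z: "square_integrable (X h)" "E (X h) = 0" for h
  proof -
    define W where "W = (\<lambda>t. g (length (children t)) + (\<Sum>c\<leftarrow>children t. X h c))"
    have X: "X (Suc h) = (\<lambda>t. f t + W t)" by (auto simp: X_def W_def)
    have W2: "square_integrable W"
      unfolding W_def by (rule square_integrable_branching[OF Z g2])
    have W1: "integrable (measure_pmf tree_pmf) W"
      by (rule measure_pmf.square_integrable_imp_integrable) (use W2 in auto)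
    have fi: "integrable (measure_pmf tree_pmf) f" "square_integrable f"
      "integrable (measure_pmf tree_pmf) (\<lambda>t. f t * W t)"
      using f by (auto intro!: integrable_finite_support elim: finite_subset[rotated])
    have EW: "E W = measure_pmf.expectation p g"
      unfolding W_def by (rule expectation_branching[OF Z g2])
    have EW2: "E (\<lambda>t. (W t)\<^sup>2) = measure_pmf.expectation p (\<lambda>k. (g k)\<^sup>2) + E (\<lambda>t. (X h t)\<^sup>2)"
      unfolding W_def by (rule expectation_branching_square[OF Z g2])
    show ?thesis
      unfolding X using fi W1 W2
      by (auto simp: power2_sum EW EW2 fg mult.assoc distrib_left simp flip: power2_eq_square)
  qed
  have "square_integrable (X h) \<and> E (X h) = 0" for h
  proof (induction h)
    case 0
    show ?case by (simp add: X_def)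
  next
    case (Suc h)
    then show ?case using step[of h] by blast
  qed
  then show ?thesis using step by blast
qed

text \<open>With toll function $f - \mu + (\mu/\sigma^2)(\xi_{\mathrm{root}} - 1)$, the second moment of the
  functional truncated at height $h$ eventually grows by exactly $\gamma^2$ per level.\<close>

lemma gamma2_nonneg:
  assumes f: "finite {t. f t \<noteq> 0}"
  shows "gamma2 p f \<ge> 0"
proof -
  define \<mu> where "\<mu> = E f"
  define v where "v = measure_pmf.variance p real"
  \<comment> \<open>Any \<open>l\<close> would centre the toll. The increment depends on it through
    l^2 v - 2 l \<mu>, which is minimal at this choice, with value -\<mu>^2/v: the last term of
    \<open>gamma2\<close>.\<close>
  define l where "l = \<mu> / v"
  define g where "g = (\<lambda>k. l * (real k - 1) - \<mu>)"
  define X where "X = truncated_functional (\<lambda>t. f t + g (length (children t)))"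
  have v: "v > 0" "v = measure_pmf.expectation p (\<lambda>k. (real k - 1)\<^sup>2)"
    using var_pos by (simp_all add: v_def mean)
  have sq: "integrable (measure_pmf p) (\<lambda>k. (real k - 1)\<^sup>2)"
    using var_finite integrable_offspring by (simp add: power2_diff)
  have g_sq: "(g k)\<^sup>2 = l\<^sup>2 * (real k - 1)\<^sup>2 - 2 * l * \<mu> * (real k - 1) + \<mu>\<^sup>2" for k
    by (simp add: g_def power2_eq_square algebra_simps)
  have g2: "integrable (measure_pmf p) (\<lambda>k. (g k)\<^sup>2)"
    unfolding g_sq using sq integrable_offspring by simp
  have Eg2: "measure_pmf.expectation p (\<lambda>k. (g k)\<^sup>2) = l\<^sup>2 * v + \<mu>\<^sup>2"
    unfolding g_sq using sq integrable_offspring by (simp add: mean v(2))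
  have Eg: "E f + measure_pmf.expectation p g = 0"
    unfolding g_def using integrable_offspring by (simp add: mean \<mu>_def)
  \<comment> \<open>By the edge count the outdegree part of the toll adds up to
    \<open>- l\<close>.\<close>
  have full: "X h t = additive_functional f t - real (tree_order t) * \<mu> - l"
    if "tree_order t \<le> h" for h t
  proof -
    have "additive_functional (\<lambda>t. f t + g (length (children t))) t =
        additive_functional (\<lambda>t. f t + (l * (real (length (children t)) - 1) + (- \<mu>) * 1)) t"
      by (simp add: g_def)
    also have "\<dots> = additive_functional f t - real (tree_order t) * \<mu> - l"
      unfolding additive_functional_add additive_functional_cmult additive_functional_outdeg
        tree_order_conv by simp
    finally show ?thesis unfolding X_def truncated_functional_eq[OF that] .
  qed
  have fi: "integrable (measure_pmf tree_pmf) (\<lambda>t. f t * Y t)" for Y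
    by (rule integrable_finite_support) (use f in \<open>auto elim: finite_subset[rotated]\<close>)
  obtain H where H: "tree_order t \<le> H" if "f t \<noteq> 0" for t
    using finite_imageI[OF f, of tree_order] by (auto simp: finite_nat_set_iff_bounded_le)
  \<comment> \<open>In the mixed term only trees in the support of \<open>f\<close> count. Their
    order is at most \<open>H\<close>, so truncation does not affect them.\<close>
  have inc: "E (\<lambda>t. (X (Suc h) t)\<^sup>2) = E (\<lambda>t. (X h t)\<^sup>2) + gamma2 p f" if "H \<le> h" for h
  proof -
    have "E (\<lambda>t. f t * X (Suc h) t) =
        E (\<lambda>t. f t * (additive_functional f t - real (tree_order t) * \<mu>) - l * f t)"
    proof (rule Bochner_Integration.integral_cong[OF refl])
      fix t
      show "f t * X (Suc h) t = f t * (additive_functional f t - real (tree_order t) * \<mu>) - l * f t"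
        using H[of t] that by (cases "f t = 0") (simp_all add: full right_diff_distrib mult.commute)
    qed
    also have "\<dots> = E (\<lambda>t. f t * (additive_functional f t - real (tree_order t) * \<mu>)) - l * \<mu>"
      using fi[of "\<lambda>_. 1"] by (subst Bochner_Integration.integral_diff[OF fi]) (auto simp: \<mu>_def)
    finally have fX: "E (\<lambda>t. f t * X (Suc h) t) = \<dots>" .
    have "E (\<lambda>t. (X (Suc h) t)\<^sup>2) = E (\<lambda>t. (X h t)\<^sup>2) + (l\<^sup>2 * v + \<mu>\<^sup>2)
        - E (\<lambda>t. (f t)\<^sup>2) + 2 * E (\<lambda>t. f t * X (Suc h) t)"
      using truncated_functional_moments[OF f g2 Eg] unfolding X_def Eg2 by blast
    moreover have "l\<^sup>2 * v - 2 * (l * \<mu>) = - (\<mu>\<^sup>2 / v)"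
      using v by (simp add: l_def field_simps power2_eq_square)
    ultimately show ?thesis
      unfolding gamma2_eq[OF f] fX \<mu>_def[symmetric] v_def[symmetric] by (simp add: algebra_simps)
  qed
  \<comment> \<open>A negative slope in \<open>n\<close> would eventually make a second moment
    negative.\<close>
  have sum: "E (\<lambda>t. (X (H + n) t)\<^sup>2) = E (\<lambda>t. (X H t)\<^sup>2) + real n * gamma2 p f" for n
    by (induction n) (simp_all add: inc algebra_simps)
  show ?thesis
  proof (rule ccontr)
    assume "\<not> gamma2 p f \<ge> 0"
    then obtain n where "E (\<lambda>t. (X H t)\<^sup>2) < real n * - gamma2 p f"
      using reals_Archimedean3[of "- gamma2 p f"] by auto
    then have "E (\<lambda>t. (X (H + n) t)\<^sup>2) < 0" using sum[of n] by simp
    moreover have "E (\<lambda>t. (X (H + n) t)\<^sup>2) \<ge> 0" by simp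
    ultimately show False by linarith
  qed
qed

end

subsection \<open>Functionals in the kernel of the variance form\<close>

lemma linear_coeff_eq_0:
  fixes b q :: real
  assumes "\<And>s. s * b + s\<^sup>2 * q \<ge> 0"
  shows "b = 0"
proof (rule ccontr)
  assume "b \<noteq> 0"
  \<comment> \<open>A positive number above \<open>q\<close>, so that the form is negative at s =
    -b/d.\<close>
  define d where "d = \<bar>q\<bar> + 1"
  have d: "d > 0" "q < d" by (auto simp: d_def)
  have "(- b / d) * b + (- b / d)\<^sup>2 * q = b\<^sup>2 / d\<^sup>2 * (q - d)"
    using d by (simp add: field_simps power2_eq_square)
  also have "\<dots> < 0"
    using d \<open>b \<noteq> 0\<close> by (intro mult_pos_neg) auto
  finally show False using assms[of "- b / d"] by simp
qed

lemma tree_order_pos: "tree_order t > 0"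
  by (cases t) (simp add: tree_order_PNode)

lemma additive_functional_eq_0:
  assumes "\<And>s. tree_order s \<le> tree_order t \<Longrightarrow> f s = 0"
  shows "additive_functional f t = 0"
  using assms
proof (induction t)
  case (PNode ts)
  have "additive_functional f c = 0" if "c \<in> set ts" for c
    using tree_order_child_less[OF that] by (intro PNode.IH[OF that] PNode.prems) simp
  then show ?case by (simp add: additive_functional_PNode PNode.prems cong: map_cong)
qed

lemma additive_functional_indicator_self: "additive_functional (\<lambda>s. of_bool (s = t)) t = 1"
proof (cases t)
  case (PNode ts)
  have "additive_functional (\<lambda>s. of_bool (s = t)) c = 0" if "c \<in> set ts" for c
    using tree_order_child_less[OF that] PNode by (intro additive_functional_eq_0) auto
  then show ?thesis by (simp add: PNode additive_functional_PNode cong: map_cong)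
qed

lemma additive_functional_indicator_larger:
  "tree_order s < tree_order t \<Longrightarrow> additive_functional (\<lambda>s. of_bool (s = t)) s = 0"
  by (rule additive_functional_eq_0) auto

context critical_offspring
begin

lemma expectation_times_indicator:
  "E (\<lambda>t. h t * of_bool (t = T)) = h T * pmf tree_pmf T"
  by (subst integral_measure_pmf_real[where A = "{T}"]) auto

text \<open>Perturbing \<^term>\<open>f\<close> by a multiple of the indicator of \<^term>\<open>T\<close> keeps \<^const>\<open>gamma2\<close> nonnegative, so the linear
  coefficient of the perturbation vanishes.\<close>

lemma additive_functional_large:
  assumes f: "finite {t. f t \<noteq> 0}" and gamma: "gamma2 p f = 0"
    and T: "pmf tree_pmf T > 0" "\<And>t. f t \<noteq> 0 \<Longrightarrow> tree_order t < tree_order T"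
  shows "additive_functional f T = E f * real (tree_order T) +
    (E (\<lambda>t. f t * real (tree_order t)) - E f + E f / measure_pmf.variance p real)"
proof -
  define \<mu> where "\<mu> = E f"
  define v where "v = measure_pmf.variance p real"
  define w where "w = pmf tree_pmf T"
  define K where "K = E (\<lambda>t. f t * real (tree_order t))"
  let ?F = "additive_functional f"
  have fT: "f T = 0" using T(2)[of T] by auto
  have fi: "integrable (measure_pmf tree_pmf) (\<lambda>t. f t * Y t)" for Y
    by (rule integrable_finite_support) (use f in \<open>auto elim: finite_subset[rotated]\<close>)
  have Ti: "integrable (measure_pmf tree_pmf) (\<lambda>t. Y t * of_bool (t = T))" for Y :: "plane_tree \<Rightarrow> real"
    by (rule integrable_finite_support) (auto intro: finite_subset[of _ "{T}"])
  \<comment> \<open>This is \<open>gamma2\<close> of \<open>f\<close> plus \<open>s\<close> times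
    the indicator of \<open>T\<close>. The coefficient of s^2 is \<open>gamma2\<close> of the
    indicator, that of \<open>s\<close> twice its polar form with \<open>f\<close>.\<close>
  have "s * (2 * w * (?F T - real (tree_order T) * \<mu> - K + \<mu> - \<mu> / v)) +
      s\<^sup>2 * (w - 2 * w\<^sup>2 * real (tree_order T) + w\<^sup>2 - w\<^sup>2 / v) \<ge> 0" for s
  proof -
    define f' where "f' = (\<lambda>t. f t + s * of_bool (t = T))"
    have f': "finite {t. f' t \<noteq> 0}"
      by (rule finite_subset[of _ "insert T {t. f t \<noteq> 0}"]) (use f in \<open>auto simp: f'_def\<close>)
    have F': "additive_functional f' t = ?F t + s * additive_functional (\<lambda>t. of_bool (t = T)) t" for t
      by (simp add: f'_def additive_functional_add additive_functional_cmult)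
    have mu': "E f' = \<mu> + s * w"
      unfolding f'_def using fi[of "\<lambda>_. 1"] Ti[of "\<lambda>_. s"] expectation_times_indicator[of "\<lambda>_. s" T]
      by (simp add: \<mu>_def w_def)
    have "(f' t)\<^sup>2 = f t * f t + s\<^sup>2 * of_bool (t = T)" for t
      by (auto simp: f'_def fT power2_eq_square)
    then have sq': "E (\<lambda>t. (f' t)\<^sup>2) = E (\<lambda>t. (f t)\<^sup>2) + s\<^sup>2 * w"
      using fi[of f] Ti[of "\<lambda>_. s\<^sup>2"] expectation_times_indicator[of "\<lambda>_. s\<^sup>2" T]
      by (simp add: w_def power2_eq_square)
    \<comment> \<open>Since \<open>T\<close> is larger than every tree in the support of
      \<open>f\<close>, the functional of the indicator vanishes on that support, and
      \<open>f T = 0\<close>.\<close>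
    have "f' t * (additive_functional f' t - real (tree_order t) * (\<mu> + s * w)) =
        f t * (?F t - real (tree_order t) * \<mu>) - s * w * (f t * real (tree_order t))
        + (s * (?F T + s - real (tree_order T) * (\<mu> + s * w))) * of_bool (t = T)" for t
      using T(2)[of t] additive_functional_indicator_larger[of t T]
      by (cases "t = T"; cases "f t = 0")
         (auto simp: f'_def[THEN fun_cong] F' fT additive_functional_indicator_self algebra_simps)
    then have cross': "E (\<lambda>t. f' t * (additive_functional f' t - real (tree_order t) * (\<mu> + s * w))) =
        E (\<lambda>t. f t * (?F t - real (tree_order t) * \<mu>)) - s * w * K
        + (s * (?F T + s - real (tree_order T) * (\<mu> + s * w))) * w"
      using fi[of "\<lambda>t. ?F t - real (tree_order t) * \<mu>"] fi[of "\<lambda>t. real (tree_order t)"]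
        Ti[of "\<lambda>_. 1"] expectation_times_indicator[of "\<lambda>_. 1" T]
      by (simp add: K_def w_def)
    have "gamma2 p f' = gamma2 p f +
        s * (2 * w * (?F T - real (tree_order T) * \<mu> - K + \<mu> - \<mu> / v)) +
        s\<^sup>2 * (w - 2 * w\<^sup>2 * real (tree_order T) + w\<^sup>2 - w\<^sup>2 / v)"
      unfolding gamma2_eq[OF f] gamma2_eq[OF f'] mu' sq' cross' \<mu>_def[symmetric] v_def[symmetric]
      by (simp add: power2_eq_square algebra_simps add_divide_distrib)
    then show ?thesis using gamma2_nonneg[OF f'] gamma by simp
  qed
  from linear_coeff_eq_0[OF this]
  have "?F T - real (tree_order T) * \<mu> - K + \<mu> - \<mu> / v = 0"
    using T(1) by (simp add: w_def)
  then show ?thesis unfolding \<mu>_def v_def K_def by (simp add: algebra_simps)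
qed

section \<open>From large trees to all trees of positive probability\<close>

lemma pmf_tree_pos_iff:
  "pmf tree_pmf (PNode ts) > 0 \<longleftrightarrow> pmf p (length ts) > 0 \<and> (\<forall>t\<in>set ts. pmf tree_pmf t > 0)"
proof -
  have "(\<Prod>t\<leftarrow>ts. pmf tree_pmf t) \<ge> 0" by (induction ts) auto
  moreover have "(\<Prod>t\<leftarrow>ts. pmf tree_pmf t) \<noteq> 0 \<longleftrightarrow> (\<forall>t\<in>set ts. pmf tree_pmf t > 0)"
    by (induction ts) (auto simp: less_le)
  ultimately show ?thesis
    by (auto simp: pmf_tree_PNode less_le)
qed

text \<open>Start from a single node and repeatedly hang \<open>r\<close> copies of the current tree
  below a new root.\<close>

lemma ex_large_tree: "\<exists>t. pmf tree_pmf t > 0 \<and> tree_order t > n"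
proof (induction n)
  case 0
  show ?case
    using pmf_0_pos by (intro exI[of _ "PNode []"]) (simp add: pmf_tree_pos_iff tree_order_PNode)
next
  case (Suc n)
  then obtain t where t: "pmf tree_pmf t > 0" "tree_order t > n" by blast
  obtain r where r: "r \<ge> 2" "pmf p r > 0" using ex_ge_2 by blast
  have "tree_order t < tree_order (PNode (replicate r t))"
    using r by (intro tree_order_child_less) simp
  then show ?case
    using t r by (intro exI[of _ "PNode (replicate r t)"]) (auto simp: pmf_tree_pos_iff)
qed

lemma additive_functional_affine:
  assumes f: "finite {t. f t \<noteq> 0}" and gamma: "gamma2 p f = 0"
  obtains \<mu> c where
    "\<And>k. k > 0 \<Longrightarrow> pmf p k > 0 \<Longrightarrow> \<mu> = (real k - 1) * c"
    "\<And>t. pmf tree_pmf t > 0 \<Longrightarrow> additive_functional f t = \<mu> * real (tree_order t) + c"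
proof -
  obtain M where M: "tree_order t \<le> M" if "f t \<noteq> 0" for t
    using finite_imageI[OF f, of tree_order] by (auto simp: finite_nat_set_iff_bounded_le)
  define \<mu> where "\<mu> = E f"
  define c where "c = E (\<lambda>t. f t * real (tree_order t)) - E f + E f / measure_pmf.variance p real"
  have large: "additive_functional f t = \<mu> * real (tree_order t) + c"
    if "pmf tree_pmf t > 0" "tree_order t > M" for t
    unfolding \<mu>_def c_def
    by (rule additive_functional_large[OF f gamma that(1)]) (use M that(2) in fastforce)
  obtain b where b: "pmf tree_pmf b > 0" "tree_order b > M" using ex_large_tree by blast
  \<comment> \<open>A child equal to \<open>b\<close> makes the whole tree larger than
    \<open>M\<close>: \<open>f\<close> vanishes at its root and \<open>large\<close> applies to it,
    whatever the other children are.\<close>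
  have branch: "(\<Sum>t\<leftarrow>ts. additive_functional f t) = \<mu> * (1 + (\<Sum>t\<leftarrow>ts. real (tree_order t))) + c"
    if ts: "pmf p (length ts) > 0" "\<forall>t\<in>set ts. pmf tree_pmf t > 0" "b \<in> set ts" for ts
  proof -
    have "tree_order (PNode ts) > M"
      using tree_order_child_less[OF ts(3)] b by simp
    moreover from this have "f (PNode ts) = 0" using M[of "PNode ts"] by auto
    moreover have "real (tree_order (PNode ts)) = 1 + (\<Sum>t\<leftarrow>ts. real (tree_order t))"
      by (simp add: tree_order_conv additive_functional_PNode)
    ultimately show ?thesis
      using large[of "PNode ts"] ts by (simp add: pmf_tree_pos_iff additive_functional_PNode)
  qed
  \<comment> \<open>For \<open>k\<close> copies of \<open>b\<close> the left side of
    \<open>branch\<close> is also k(\<mu>|b| + c); compare.\<close>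
  have degree: "\<mu> = (real k - 1) * c" if "k > 0" "pmf p k > 0" for k
    using branch[of "replicate k b"] that b large[OF b]
    by (simp add: map_replicate sum_list_replicate algebra_simps)
  obtain r where r: "r \<ge> 2" "pmf p r > 0" using ex_ge_2 by blast
  \<comment> \<open>Put \<open>t\<close> beside \<open>r - 1 \<ge> 1\<close> copies of
    \<open>b\<close>, whose values are known. The surplus \<mu> - (r - 1)c is zero by
    \<open>degree\<close>.\<close>
  have "additive_functional f t = \<mu> * real (tree_order t) + c" if "pmf tree_pmf t > 0" for t
  proof -
    let ?m = "real (r - 1)"
    have "additive_functional f t + ?m * (\<mu> * real (tree_order b) + c) =
        \<mu> * (1 + (real (tree_order t) + ?m * real (tree_order b))) + c"
      using branch[of "t # replicate (r - 1) b"] that b r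
      by (simp add: sum_list_replicate large[OF b] del: of_nat_diff)
    then have "additive_functional f t = \<mu> * real (tree_order t) + c + (\<mu> - ?m * c)"
      by (simp add: algebra_simps del: of_nat_diff)
    moreover have "\<mu> - ?m * c = 0" using degree[of r] r by (simp add: of_nat_diff)
    ultimately show ?thesis by simp
  qed
  with degree show ?thesis by (rule that)
qed

lemma AE_GW_iff: "(AE t in GW p. P t) \<longleftrightarrow> (\<forall>t. pmf tree_pmf t > 0 \<longrightarrow> P t)"
  unfolding GW_eq by (auto simp: AE_measure_pmf_iff pmf_positive_iff)

lemma AE_GW_condI:
  assumes "\<And>t. pmf tree_pmf t > 0 \<Longrightarrow> tree_order t = n \<Longrightarrow> P t"
  shows "AE t in GW_cond p n. P t"
  unfolding GW_cond_def
  by (rule AE_uniform_measureI) (use assms in \<open>auto simp: AE_GW_iff, simp add: GW_eq\<close>)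

end

section \<open>The two cases for the offspring support\<close>

theorem theorem1p9:
  fixes p :: "nat pmf" and f :: "plane_tree \<Rightarrow> real"
  assumes mean: "measure_pmf.expectation p real = 1"
    and var_finite: "integrable (measure_pmf p) (\<lambda>k. (real k)\<^sup>2)"
    and var_pos: "measure_pmf.variance p real > 0"
    and support: "finite {t. f t \<noteq> 0}"
    and gamma: "gamma2 p f = 0"
  shows "((\<exists>j k. 0 < j \<and> j < k \<and> pmf p j > 0 \<and> pmf p k > 0) \<longrightarrow>
            (AE t in GW p. f t = 0 \<and> additive_functional f t = 0) \<and>
            (\<forall>n. prob_space.prob (GW p) {t. tree_order t = n} > 0 \<longrightarrow>
              (AE t in GW_cond p n. additive_functional f t = 0))) \<and>
         (\<not> (\<exists>j k. 0 < j \<and> j < k \<and> pmf p j > 0 \<and> pmf p k > 0) \<longrightarrow>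
            (\<exists>r>1. {k. pmf p k > 0} = {0, r} \<and>
              (\<exists>a. (AE t in GW p. f t = a * of_bool (tree_order t = 1)) \<and>
                (\<forall>n. prob_space.prob (GW p) {t. tree_order t = n} > 0 \<longrightarrow>
                  (AE t in GW_cond p n. additive_functional f t = a * (real n - (real n - 1) / real r))))))"
proof -
  interpret critical_offspring p
    by unfold_locales (rule mean var_finite var_pos)+
  obtain \<mu> c where degree: "\<And>k. k > 0 \<Longrightarrow> pmf p k > 0 \<Longrightarrow> \<mu> = (real k - 1) * c"
    and affine: "\<And>t. pmf tree_pmf t > 0 \<Longrightarrow> additive_functional f t = \<mu> * real (tree_order t) + c"
    using additive_functional_affine[OF support gamma] by blast
  \<comment> \<open>The toll is the value at the tree minus the values at its children; in the
    affine formula the orders cancel up to the root.\<close>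
  have toll: "f (PNode ts) = \<mu> - (real (length ts) - 1) * c" if "pmf tree_pmf (PNode ts) > 0" for ts
  proof -
    have "(\<Sum>t\<leftarrow>ts. additive_functional f t) = (\<Sum>t\<leftarrow>ts. \<mu> * real (tree_order t) + c)"
      using that affine by (intro arg_cong[where f = sum_list] map_cong) (auto simp: pmf_tree_pos_iff)
    then show ?thesis
      using affine[OF that]
      by (simp add: additive_functional_PNode tree_order_conv sum_list_addf sum_list_const_mult
          sum_list_triv algebra_simps)
  qed
  show ?thesis
  proof (intro conjI impI)
    assume "\<exists>j k. 0 < j \<and> j < k \<and> pmf p j > 0 \<and> pmf p k > 0"
    then obtain j k where jk: "0 < j" "j < k" "pmf p j > 0" "pmf p k > 0" by blast
    \<comment> \<open>Two distinct positive degrees determine the same \<mu>, which leaves only c =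
      0.\<close>
    then have "(real j - 1) * c = (real k - 1) * c" using degree[of j] degree[of k] by simp
    then have c: "c = 0" using jk by simp
    then have \<mu>: "\<mu> = 0" using degree[of j] jk by simp
    have f0: "f t = 0" if "pmf tree_pmf t > 0" for t
      using toll[of "children t"] that by (simp add: c \<mu>)
    show "AE t in GW p. f t = 0 \<and> additive_functional f t = 0"
      using f0 affine by (simp add: AE_GW_iff c \<mu>)
    show "\<forall>n. prob_space.prob (GW p) {t. tree_order t = n} > 0 \<longrightarrow>
        (AE t in GW_cond p n. additive_functional f t = 0)"
      using affine by (auto intro!: AE_GW_condI simp: c \<mu>)
  next
    assume single: "\<not> (\<exists>j k. 0 < j \<and> j < k \<and> pmf p j > 0 \<and> pmf p k > 0)"
    obtain r where r: "r \<ge> 2" "pmf p r > 0" using ex_ge_2 by blast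
    have "k = r" if "k > 0" "pmf p k > 0" for k
      using single that r by (metis less_le_trans linorder_neqE_nat pos2)
    then have supp: "{k. pmf p k > 0} = {0, r}"
      using r pmf_0_pos by auto
    have \<mu>: "\<mu> = (real r - 1) * c" using degree[of r] r by simp
    \<comment> \<open>By \<open>toll\<close>, a leaf has value \<mu> + c = r c, which is the
      constant \<open>a\<close>, and a root of outdegree \<open>r\<close> has value \<mu> - (r - 1)c
      = 0.\<close>
    have f: "f t = (real r * c) * of_bool (tree_order t = 1)" if pos: "pmf tree_pmf t > 0" for t
    proof (cases t)
      case (PNode ts)
      have "length ts \<in> {0, r}" using pos supp by (auto simp: PNode pmf_tree_pos_iff)
      then consider "ts = []" | "length ts = r" by auto
      then show ?thesis
      proof cases
        case 1
        then show ?thesis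
          using toll[of ts] pos by (simp add: PNode tree_order_PNode \<mu> algebra_simps)
      next
        case 2
        then obtain s where s: "s \<in> set ts" using r by (cases ts) auto
        have "tree_order t \<noteq> 1"
          using tree_order_child_less[OF s] tree_order_pos[of s] PNode by simp
        then show ?thesis
          using toll[of ts] pos 2 by (simp add: PNode \<mu>)
      qed
    qed
    have F: "additive_functional f t = (real r * c) * (real n - (real n - 1) / real r)"
      if "pmf tree_pmf t > 0" "tree_order t = n" for t n
      unfolding affine[OF that(1)] that(2) \<mu> using r by (simp add: field_simps)
    show "\<exists>r>1. {k. pmf p k > 0} = {0, r} \<and>
        (\<exists>a. (AE t in GW p. f t = a * of_bool (tree_order t = 1)) \<and>
          (\<forall>n. prob_space.prob (GW p) {t. tree_order t = n} > 0 \<longrightarrow>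
            (AE t in GW_cond p n. additive_functional f t = a * (real n - (real n - 1) / real r))))"
    proof (intro exI[of _ r] conjI exI[of _ "real r * c"] allI impI)
      show "AE t in GW p. f t = (real r * c) * of_bool (tree_order t = 1)"
        using f by (simp add: AE_GW_iff)
      show "AE t in GW_cond p n. additive_functional f t = (real r * c) * (real n - (real n - 1) / real r)" for n
        using F by (intro AE_GW_condI)
    qed (use r supp in auto)
  qed
qed

end
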